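(* Let $a,b\in\mathbb C$ be non-zero. The exchange relations $$(a\mathsf W_0+b\mathsf W_1)\,\mathsf I_{2k+1}=\mathsf I'_{2k+1}\,(a\mathsf W_0+b\mathsf W_1)\qquad\text{for all }k\in\mathbb N$$ hold in $\mathcal A_q$ if and only if the parameters satisfy $$\bar\varepsilon_\pm'=\bar\varepsilon_\pm,\qquad\bar\varepsilon_-=\frac ba\,\bar\varepsilon_+,\qquad\bar k_\pm=\bar k_\pm'=0.$$
   Context: $q\in\mathbb C^*$ is not a root of unity, $\mathbb N=\{0,1,\dots\}$, $[X,Y]_q=qXY-q^{-1}YX$. Fix $k_\pm\in\mathbb C^*$, $\rho=k_+k_-(q+q^{-1})^2$. $\mathcal A_q$ is the unital associative $\mathbb C$-algebra generated by $\mathsf W_{-k},\mathsf W_{k+1},\mathsf G_{k+1},\tilde{\mathsf G}_{k+1}$ ($k\in\mathbb N$) with, for all $k,l\in\mathbb N$: $[\mathsf W_0,\mathsf W_{k+1}]=[\mathsf W_{-k},\mathsf W_1]=\frac{\tilde{\mathsf G}_{k+1}-\mathsf G_{k+1}}{q+q^{-1}}$; $[\mathsf W_0,\mathsf G_{k+1}]_q=[\tilde{\mathsf G}_{k+1},\mathsf W_0]_q=\rho(\mathsf W_{-k-1}-\mathsf W_{k+1})$; $[\mathsf G_{k+1},\mathsf W_1]_q=[\mathsf W_1,\tilde{\mathsf G}_{k+1}]_q=\rho(\mathsf W_{k+2}-\mathsf W_{-k})$; $[\mathsf W_{-k},\mathsf W_{-l}]=[\mathsf W_{k+1},\mathsf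 W_{l+1}]=[\mathsf G_{k+1},\mathsf G_{l+1}]=[\tilde{\mathsf G}_{k+1},\tilde{\mathsf G}_{l+1}]=0$; $[\mathsf W_{-k},\mathsf W_{l+1}]+[\mathsf W_{k+1},\mathsf W_{-l}]=0$; $[\mathsf W_{-k},\mathsf G_{l+1}]+[\mathsf G_{k+1},\mathsf W_{-l}]=0$; $[\mathsf W_{-k},\tilde{\mathsf G}_{l+1}]+[\tilde{\mathsf G}_{k+1},\mathsf W_{-l}]=0$; $[\mathsf W_{k+1},\mathsf G_{l+1}]+[\mathsf G_{k+1},\mathsf W_{l+1}]=0$; $[\mathsf W_{k+1},\tilde{\mathsf G}_{l+1}]+[\tilde{\mathsf G}_{k+1},\mathsf W_{l+1}]=0$; $[\tilde{\mathsf G}_{k+1},\mathsf G_{l+1}]+[\mathsf G_{k+1},\tilde{\mathsf G}_{l+1}]=0$. (Known fact: $\mathcal A_q$ has a PBW basis in these generators for the order $\mathsf W_{-k}<\mathsf G_{\ell+1}<\tilde{\mathsf G}_{m+1}<\mathsf W_{n+1}$.) For $\bar\varepsilon_\pm,\bar k_\pm,\bar\varepsilon_\pm',\bar k_\pm'\in\mathbb C$: $\mathsf I_{2k+1}=\bar\varepsilon_+\mathsf W_{-k}+\bar\varepsilon_-\mathsf W_{k+1}+\frac1{q^2-q^{-2}}\Big(\frac{\bar k_-}{k_-}\mathsf G_{k+1}+\frac{\bar k_+}{k_+}\tilde{\mathsf G}_{k+1}\Big)$ and $\mathsf I'_{2k+1}$ is the same expression with $\bar\varepsilon_\pm,\bar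 k_\pm$ replaced by $\bar\varepsilon_\pm',\bar k_\pm'$. *)

theory Defs
  imports Complex_Main "HOL-Library.Poly_Mapping"
    "HOL-Algebra.Algebraic_Closure_Type" "HOL-Algebra.Module"
begin

section \<open>The free unital associative algebra over the complex numbers\<close>

text \<open>
  Words form the free monoid. It is written additively, because the multiplication of
  \<^typ>\<open>'k \<Rightarrow>\<^sub>0 'r\<close> is the convolution with respect to addition on the keys. A wrapper type is
  used so that no class instance is imposed on lists.
\<close>

datatype 'g free_word = Word (letters: "'g list")

instantiation free_word :: (type) monoid_add
begin

definition zero_free_word :: "'a free_word"
  where "0 = Word []"

definition plus_free_word :: "'a free_word \<Rightarrow> 'a free_word \<Rightarrow> 'a free_word"
  where "u + v = Word (letters u @ letters v)"

instance
  by standard (simp_all add: zero_free_word_def plus_free_word_def)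

end

type_synonym 'g free_algebra = "'g free_word \<Rightarrow>\<^sub>0 complex"

definition gen :: "'g \<Rightarrow> 'g free_algebra"
  where "gen x = Poly_Mapping.single (Word [x]) 1"

definition scal :: "complex \<Rightarrow> 'g free_algebra"
  where "scal c = Poly_Mapping.single 0 c"


section \<open>The algebra \<open>\<A>\<^sub>q\<close>\<close>

text \<open>
  The generators \<open>\<W>\<^bsub>-k\<^esub>\<close> and \<open>\<W>\<^bsub>k+1\<^esub>\<close> with \<open>k \<in> \<nat>\<close> are together indexed, without repetition,
  by all integers. The generators \<open>\<G>\<close> and \<open>\<G>~\<close> carry indices starting at 1: \<open>G_suc k\<close> stands for
  \<open>\<G>\<^bsub>k+1\<^esub>\<close> and \<open>Gt_suc k\<close> for \<open>\<G>~\<^bsub>k+1\<^esub>\<close>, so that there is no generator of index 0.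
\<close>

datatype generator = W_idx int | G_suc nat | Gt_suc nat

abbreviation W :: "int \<Rightarrow> generator free_algebra"
  where "W n \<equiv> gen (W_idx n)"

abbreviation G1 :: "nat \<Rightarrow> generator free_algebra"
  where "G1 k \<equiv> gen (G_suc k)"

abbreviation Gt1 :: "nat \<Rightarrow> generator free_algebra"
  where "Gt1 k \<equiv> gen (Gt_suc k)"

definition commutator :: "'g free_algebra \<Rightarrow> 'g free_algebra \<Rightarrow> 'g free_algebra"
  where "commutator x y = x * y - y * x"

definition q_commutator ::
    "complex \<Rightarrow> 'g free_algebra \<Rightarrow> 'g free_algebra \<Rightarrow> 'g free_algebra"
  where "q_commutator q x y = scal q * (x * y) - scal (inverse q) * (y * x)"

definition rho :: "complex \<Rightarrow> complex \<Rightarrow> complex \<Rightarrow> complex"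
  where "rho q kp km = kp * km * (q + inverse q)\<^sup>2"

text \<open>\<open>Aq_rel q kp km x y\<close> means that \<open>x = y\<close> is one of the defining relations.\<close>

inductive Aq_rel ::
    "complex \<Rightarrow> complex \<Rightarrow> complex \<Rightarrow> generator free_algebra \<Rightarrow> generator free_algebra \<Rightarrow> bool"
  for q kp km :: complex
where
  W0_W: "Aq_rel q kp km (commutator (W 0) (W (int k + 1)))
           (scal (1 / (q + inverse q)) * (Gt1 k - G1 k))"
| W_W1: "Aq_rel q kp km (commutator (W (- int k)) (W 1))
           (scal (1 / (q + inverse q)) * (Gt1 k - G1 k))"
| W0_G: "Aq_rel q kp km (q_commutator q (W 0) (G1 k))
           (scal (rho q kp km) * (W (- int k - 1) - W (int k + 1)))"
| Gt_W0: "Aq_rel q kp km (q_commutator q (Gt1 k) (W 0))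
           (scal (rho q kp km) * (W (- int k - 1) - W (int k + 1)))"
| G_W1: "Aq_rel q kp km (q_commutator q (G1 k) (W 1))
           (scal (rho q kp km) * (W (int k + 2) - W (- int k)))"
| W1_Gt: "Aq_rel q kp km (q_commutator q (W 1) (Gt1 k))
           (scal (rho q kp km) * (W (int k + 2) - W (- int k)))"
| Wm_Wm: "Aq_rel q kp km (commutator (W (- int k)) (W (- int l))) 0"
| Wp_Wp: "Aq_rel q kp km (commutator (W (int k + 1)) (W (int l + 1))) 0"
| G_G: "Aq_rel q kp km (commutator (G1 k) (G1 l)) 0"
| Gt_Gt: "Aq_rel q kp km (commutator (Gt1 k) (Gt1 l)) 0"
| Wm_Wp: "Aq_rel q kp km
    (commutator (W (- int k)) (W (int l + 1)) + commutator (W (int k + 1)) (W (- int l))) 0"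
| Wm_G: "Aq_rel q kp km
    (commutator (W (- int k)) (G1 l) + commutator (G1 k) (W (- int l))) 0"
| Wm_Gt: "Aq_rel q kp km
    (commutator (W (- int k)) (Gt1 l) + commutator (Gt1 k) (W (- int l))) 0"
| Wp_G: "Aq_rel q kp km
    (commutator (W (int k + 1)) (G1 l) + commutator (G1 k) (W (int l + 1))) 0"
| Wp_Gt: "Aq_rel q kp km
    (commutator (W (int k + 1)) (Gt1 l) + commutator (Gt1 k) (W (int l + 1))) 0"
| Gt_G: "Aq_rel q kp km
    (commutator (Gt1 k) (G1 l) + commutator (G1 k) (Gt1 l)) 0"

definition Aq_ideal :: "complex \<Rightarrow> complex \<Rightarrow> complex \<Rightarrow> generator free_algebra set"
  where "Aq_ideal q kp km = Idl\<^bsub>ring_of_type_algebra\<^esub> {x - y | x y. Aq_rel q kp km x y}"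

definition Aq_class ::
    "complex \<Rightarrow> complex \<Rightarrow> complex \<Rightarrow> generator free_algebra \<Rightarrow> generator free_algebra set"
  where "Aq_class q kp km x = Aq_ideal q kp km +>\<^bsub>ring_of_type_algebra\<^esub> x"

text \<open>
  The \<^typ>\<open>('r, 'm) module\<close> record is the ring record extended by a scalar multiplication;
  it is used here for an algebra over the complex numbers.
\<close>

definition Aq ::
    "complex \<Rightarrow> complex \<Rightarrow> complex \<Rightarrow> (complex, generator free_algebra set) module"
  where "Aq q kp km =
    (let Q = ring_of_type_algebra Quot Aq_ideal q kp km in
      \<lparr>carrier = carrier Q, monoid.mult = monoid.mult Q, one = one Q,
       ring.zero = ring.zero Q, add = add Q,
       module.smult = (\<lambda>c x. Aq_class q kp km (scal c) \<otimes>\<^bsub>Q\<^esub> x)\<rparr>)"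

definition Wq :: "complex \<Rightarrow> complex \<Rightarrow> complex \<Rightarrow> int \<Rightarrow> generator free_algebra set"
  where "Wq q kp km n = Aq_class q kp km (W n)"

definition Gq1 :: "complex \<Rightarrow> complex \<Rightarrow> complex \<Rightarrow> nat \<Rightarrow> generator free_algebra set"
  where "Gq1 q kp km k = Aq_class q kp km (G1 k)"

definition Gtq1 :: "complex \<Rightarrow> complex \<Rightarrow> complex \<Rightarrow> nat \<Rightarrow> generator free_algebra set"
  where "Gtq1 q kp km k = Aq_class q kp km (Gt1 k)"

text \<open>
  \<open>I_odd q kp km ep em lp lm k\<close> is the element \<open>\<I>\<^bsub>2k+1\<^esub>\<close> with \<open>ep\<close>, \<open>em\<close> for the parameters
  \<open>\<epsilon>\<close>-bar and \<open>lp\<close>, \<open>lm\<close> for the parameters \<open>k\<close>-bar (with index \<open>+\<close> and \<open>-\<close>).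
  Note that \<open>lm / km\<close> goes with \<open>\<G>\<close> and \<open>lp / kp\<close> with \<open>\<G>~\<close>.
\<close>

definition I_odd ::
    "complex \<Rightarrow> complex \<Rightarrow> complex \<Rightarrow> complex \<Rightarrow> complex \<Rightarrow> complex \<Rightarrow> complex \<Rightarrow> nat
      \<Rightarrow> generator free_algebra set"
  where "I_odd q kp km ep em lp lm k =
    (let A = Aq q kp km in
      (ep \<odot>\<^bsub>A\<^esub> Wq q kp km (- int k) \<oplus>\<^bsub>A\<^esub> em \<odot>\<^bsub>A\<^esub> Wq q kp km (int k + 1)) \<oplus>\<^bsub>A\<^esub>
      (1 / (q\<^sup>2 - inverse (q\<^sup>2))) \<odot>\<^bsub>A\<^esub>
        ((lm / km) \<odot>\<^bsub>A\<^esub> Gq1 q kp km k \<oplus>\<^bsub>A\<^esub> (lp / kp) \<odot>\<^bsub>A\<^esub> Gtq1 q kp km k))"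

end

theory Submission
  imports Defs
begin

text \<open>
  Write \<open>Y = a \<W>\<^sub>0 + b \<W>\<^sub>1\<close>. The parameter conditions suffice because, for
  \<open>a em = b ep\<close>, the commutator of \<open>Y\<close> with \<open>ep \<W>\<^bsub>-k\<^esub> + em \<W>\<^bsub>k+1\<^esub>\<close> is a combination of
  \<open>[\<W>\<^sub>0, \<W>\<^bsub>-k\<^esub>] = 0\<close>, \<open>[\<W>\<^sub>1, \<W>\<^bsub>k+1\<^esub>] = 0\<close> and \<open>[\<W>\<^sub>0, \<W>\<^bsub>k+1\<^esub>] - [\<W>\<^bsub>-k\<^esub>, \<W>\<^sub>1] = 0\<close>
  (\<open>exchange_sufficient\<close>).

  Conversely, the relation for \<open>k = 0\<close> alone forces the conditions. With a PBW basis one would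
  compare coefficients. Instead, the relation is evaluated in representations of the algebra by
  upper triangular matrices of size two, which already separate the monomials that occur. The
  representations are of a special kind (\<open>truncated_rep_rel\<close>): all \<open>\<G>\<close> and \<open>\<G>~\<close> of index at
  least 2 act by 0, and every \<open>\<W>\<^sub>n\<close> with \<open>n \<noteq> 0, 1\<close> acts by a central element that depends only on
  the parity of \<open>n\<close>. The infinite list of relations then collapses to those
  between \<open>\<W>\<^sub>0\<close>, \<open>\<W>\<^sub>1\<close>, \<open>\<G>\<^sub>1\<close>, \<open>\<G>~\<^sub>1\<close>, which are of Askey--Wilson type.

  Scalar representations send \<open>\<W>\<^sub>0\<close>, \<open>\<W>\<^sub>1\<close> and \<open>\<G>\<^sub>1 = \<G>~\<^sub>1\<close> to arbitrary numbers
  (\<open>exchange_character\<close>). They give \<open>ep' = ep\<close>, \<open>em' = em\<close> and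
  \<open>lm'/km + lp'/kp = lm/km + lp/kp\<close>. There is a further family in which \<open>\<W>\<^sub>0\<close> is diagonal and
  \<open>\<W>\<^sub>1\<close> has the entry 1 above the diagonal (\<open>exchange_triangular\<close>). It depends on two
  non-zero parameters \<open>P\<close>, \<open>M\<close>, and the entry of the exchange relation above the diagonal is a Laurent
  polynomial in them. Its coefficients of \<open>P\<^sup>2\<close>, \<open>P\<^bsup>-2\<^esup>\<close>, \<open>P M\<^bsup>-1\<^esup>\<close>, \<open>P\<^bsup>-1\<^esup> M\<close> show that the four
  \<open>k\<close>-bar parameters vanish, as \<open>q\<^sup>4 \<noteq> 1\<close>, and its coefficient of \<open>P\<close> gives
  \<open>a em = b ep\<close> (\<open>triangular_entries_force\<close>).
\<close>

section \<open>Evaluation homomorphisms of the free algebra\<close>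

lemma poly_mapping_expand:
  "p = (\<Sum>w\<in>Poly_Mapping.keys p. Poly_Mapping.single w (Poly_Mapping.lookup p w))"
  by (rule poly_mapping_eqI) (auto simp: lookup_sum lookup_single when_def in_keys_iff sum.delta)

text \<open>
  The algebra homomorphism out of the free algebra that sends the generator \<open>x\<close> to \<open>\<phi> x\<close>. The
  target is a ring made into a complex algebra by \<open>s\<close>, which sends a complex number to the
  corresponding central scalar.
\<close>

definition free_eval ::
    "(complex \<Rightarrow> 'r::ring_1) \<Rightarrow> ('g \<Rightarrow> 'r) \<Rightarrow> 'g free_algebra \<Rightarrow> 'r"
  where "free_eval s \<phi> p =
    (\<Sum>w\<in>Poly_Mapping.keys p. s (Poly_Mapping.lookup p w) * prod_list (map \<phi> (letters w)))"

text \<open>The map \<open>s\<close> makes the ring \<open>'r\<close> a unital associative algebra over the complex numbers.\<close>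

locale central_scalars =
  fixes s :: "complex \<Rightarrow> 'r::ring_1"
  assumes s_add: "s (c + d) = s c + s d"
    and s_mult: "s (c * d) = s c * s d"
    and s_one: "s 1 = 1"
    and s_central: "s c * x = x * s c"
begin

lemma s_zero: "s 0 = 0"
  using s_add[of 0 0] by simp

lemma free_eval_superset:
  assumes "finite K" "Poly_Mapping.keys p \<subseteq> K"
  shows "free_eval s \<phi> p =
    (\<Sum>w\<in>K. s (Poly_Mapping.lookup p w) * prod_list (map \<phi> (letters w)))"
  unfolding free_eval_def
  by (rule sum.mono_neutral_left) (use assms in \<open>auto simp: in_keys_iff s_zero\<close>)

lemma free_eval_add: "free_eval s \<phi> (p + r) = free_eval s \<phi> p + free_eval s \<phi> r"
proof -
  let ?K = "Poly_Mapping.keys p \<union> Poly_Mapping.keys r"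
  have "Poly_Mapping.keys (p + r) \<subseteq> ?K" by (rule Poly_Mapping.keys_add)
  then show ?thesis
    by (simp add: free_eval_superset[of ?K] lookup_add s_add distrib_right sum.distrib)
qed

lemma free_eval_zero: "free_eval s \<phi> 0 = 0"
  by (simp add: free_eval_def)

lemma free_eval_diff: "free_eval s \<phi> (p - r) = free_eval s \<phi> p - free_eval s \<phi> r"
  using free_eval_add[of \<phi> "p - r" r] by (simp add: algebra_simps)

lemma free_eval_sum: "free_eval s \<phi> (sum f K) = (\<Sum>k\<in>K. free_eval s \<phi> (f k))"
  by (induction K rule: infinite_finite_induct) (simp_all add: free_eval_zero free_eval_add)

lemma free_eval_single:
  "free_eval s \<phi> (Poly_Mapping.single w c) = s c * prod_list (map \<phi> (letters w))"
  by (subst free_eval_superset[of "{w}"]) auto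

lemma free_eval_mult: "free_eval s \<phi> (p * r) = free_eval s \<phi> p * free_eval s \<phi> r"
proof -
  have mono: "free_eval s \<phi> (Poly_Mapping.single u c * Poly_Mapping.single v d)
      = free_eval s \<phi> (Poly_Mapping.single u c) * free_eval s \<phi> (Poly_Mapping.single v d)" for u v c d
    unfolding mult_single free_eval_single
    by (simp add: plus_free_word_def s_mult s_central[of d] mult.assoc)
  have "free_eval s \<phi> ((\<Sum>u\<in>Poly_Mapping.keys p. Poly_Mapping.single u (Poly_Mapping.lookup p u)) *
        (\<Sum>v\<in>Poly_Mapping.keys r. Poly_Mapping.single v (Poly_Mapping.lookup r v))) =
      free_eval s \<phi> (\<Sum>u\<in>Poly_Mapping.keys p. Poly_Mapping.single u (Poly_Mapping.lookup p u)) *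
      free_eval s \<phi> (\<Sum>v\<in>Poly_Mapping.keys r. Poly_Mapping.single v (Poly_Mapping.lookup r v))"
    by (simp only: sum_product free_eval_sum mono)
  then show ?thesis
    by (simp only: poly_mapping_expand[symmetric])
qed

lemma free_eval_scal: "free_eval s \<phi> (scal c) = s c"
  by (simp add: scal_def free_eval_single zero_free_word_def)

lemma free_eval_gen: "free_eval s \<phi> (gen x) = \<phi> x"
  by (simp add: gen_def free_eval_single s_one)

lemmas free_eval_simps = free_eval_add free_eval_zero free_eval_diff free_eval_mult
  free_eval_scal free_eval_gen

end

lemma scal_mult: "scal (c * d) = scal c * scal d"
  by (simp add: scal_def mult_single)

lemma scal_zero: "scal 0 = 0"
  by (simp add: scal_def)

lemma scal_diff: "scal (c - d) = scal c - scal d"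
  by (simp add: scal_def single_diff)

lemma scal_minus: "scal (- c) = - scal c"
  using scal_diff[of 0 c] by (simp add: scal_zero)

lemma scal_central: "scal c * p = p * scal c"
proof -
  have "scal c * (\<Sum>w\<in>K. Poly_Mapping.single w (f w)) = (\<Sum>w\<in>K. Poly_Mapping.single w (f w)) * scal c"
    for K and f :: "'a free_word \<Rightarrow> complex"
    by (simp add: sum_distrib_left sum_distrib_right scal_def mult_single mult.commute)
  from this[of "Poly_Mapping.lookup p" "Poly_Mapping.keys p"] show ?thesis
    by (simp only: poly_mapping_expand[symmetric])
qed

section \<open>Calculation in \<open>\<A>\<^sub>q\<close>\<close>

lemma ring_of_type_algebra_ring: "ring (ring_of_type_algebra :: 'a::ring_1 ring)"
proof -
  have "\<exists>y. x + y = 0" for x :: 'a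
    using add.right_inverse by blast
  then show ?thesis
    unfolding ring_of_type_algebra_def using add.right_inverse
    by unfold_locales (auto simp: algebra_simps Units_def)
qed

lemma ideal_Aq_ideal: "ideal (Aq_ideal q kp km) ring_of_type_algebra"
  unfolding Aq_ideal_def
  by (rule ring.genideal_ideal[OF ring_of_type_algebra_ring]) (simp add: ring_of_type_algebra_def)

lemma Aq_class_mult: "Aq_class q kp km x \<otimes>\<^bsub>Aq q kp km\<^esub> Aq_class q kp km y = Aq_class q kp km (x * y)"
  using ideal.rcoset_mult_add[OF ideal_Aq_ideal, of x y q kp km]
  by (simp add: Aq_def Aq_class_def FactRing_def ring_of_type_algebra_def)

lemma Aq_class_add: "Aq_class q kp km x \<oplus>\<^bsub>Aq q kp km\<^esub> Aq_class q kp km y = Aq_class q kp km (x + y)"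
  using ideal.a_rcos_sum[OF ideal_Aq_ideal, of x y q kp km]
  by (simp add: Aq_def Aq_class_def FactRing_def ring_of_type_algebra_def)

lemma Aq_class_smult: "c \<odot>\<^bsub>Aq q kp km\<^esub> Aq_class q kp km y = Aq_class q kp km (scal c * y)"
  using Aq_class_mult[of q kp km "scal c" y] by (simp add: Aq_def Let_def)

lemma minus_ring_of_type_algebra: "x \<ominus>\<^bsub>ring_of_type_algebra\<^esub> y = x - (y::'a::ring_1)"
proof -
  interpret R: ring "ring_of_type_algebra :: 'a ring" by (rule ring_of_type_algebra_ring)
  have "\<ominus>\<^bsub>ring_of_type_algebra\<^esub> y = - y"
    by (rule R.minus_equality) (simp_all add: ring_of_type_algebra_def)
  then show ?thesis by (simp add: a_minus_def) (simp add: ring_of_type_algebra_def)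
qed

lemma Aq_class_eq_iff: "Aq_class q kp km x = Aq_class q kp km y \<longleftrightarrow> x - y \<in> Aq_ideal q kp km"
  using ring.quotient_eq_iff_same_a_r_cos[OF ring_of_type_algebra_ring ideal_Aq_ideal, of x y q kp km]
  by (simp add: Aq_class_def minus_ring_of_type_algebra) (simp add: ring_of_type_algebra_def)

lemma Aq_class_eqI: "Aq_rel q kp km x y \<Longrightarrow> Aq_class q kp km x = Aq_class q kp km y"
  unfolding Aq_class_eq_iff Aq_ideal_def
  by (rule subsetD[OF ring.genideal_self[OF ring_of_type_algebra_ring]])
    (auto simp: ring_of_type_algebra_def)

text \<open>An evaluation that respects the defining relations factors through \<open>\<A>\<^sub>q\<close>.\<close>

lemma (in central_scalars) free_eval_Aq_class:
  assumes rel: "\<And>x y. Aq_rel q kp km x y \<Longrightarrow> free_eval s \<phi> x = free_eval s \<phi> y"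
    and eq: "Aq_class q kp km x = Aq_class q kp km y"
  shows "free_eval s \<phi> x = free_eval s \<phi> y"
proof -
  interpret R: ring "ring_of_type_algebra :: generator free_algebra ring"
    by (rule ring_of_type_algebra_ring)
  let ?J = "{x. free_eval s \<phi> x = 0}"
  have inv: "\<ominus>\<^bsub>ring_of_type_algebra\<^esub> x = - x" for x :: "generator free_algebra"
    by (rule R.minus_equality) (simp_all add: ring_of_type_algebra_def)
  have "ideal ?J (ring_of_type_algebra :: generator free_algebra ring)"
  proof (rule idealI)
    show "subgroup ?J (add_monoid (ring_of_type_algebra :: generator free_algebra ring))"
    proof (rule R.add.subgroupI, goal_cases)
      case (3 a)
      then show ?case using free_eval_diff[of \<phi> 0 a] by (simp add: inv free_eval_zero)
    qed (auto simp: ring_of_type_algebra_def free_eval_simps intro: exI[of _ 0])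
  qed (auto simp: ring_of_type_algebra_def free_eval_simps
      intro: ring_of_type_algebra_ring[unfolded ring_of_type_algebra_def])
  then have "Aq_ideal q kp km \<subseteq> ?J"
    unfolding Aq_ideal_def
    by (rule R.genideal_minimal) (auto simp: free_eval_diff rel)
  then show ?thesis using eq by (auto simp: Aq_class_eq_iff free_eval_diff)
qed

section \<open>Truncated representations\<close>

text \<open>
  The images of the generators: \<open>A\<close>, \<open>B\<close> for \<open>\<W>\<^sub>0\<close>, \<open>\<W>\<^sub>1\<close>, and \<open>G\<close>, \<open>H\<close> for \<open>\<G>\<^sub>1\<close>, \<open>\<G>~\<^sub>1\<close>.
  The remaining \<open>\<G>\<close>, \<open>\<G>~\<close> go to 0, so the relations between them and \<open>\<W>\<^sub>0\<close>, \<open>\<W>\<^sub>1\<close> leave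
  \<open>\<W>\<^bsub>-k-1\<^esub> = \<W>\<^bsub>k+1\<^esub>\<close> and \<open>\<W>\<^bsub>k+2\<^esub> = \<W>\<^bsub>-k\<^esub>\<close> for \<open>k \<ge> 1\<close>. Hence the remaining \<open>\<W>\<^sub>n\<close> go
  to \<open>x\<close>, the image of \<open>\<W>\<^bsub>-1\<^esub>\<close>, for odd \<open>n\<close>, and to \<open>y\<close>, the image of \<open>\<W>\<^sub>2\<close>, for even \<open>n\<close>.
\<close>

fun truncated_rep ::
    "'r \<Rightarrow> 'r \<Rightarrow> 'r \<Rightarrow> 'r \<Rightarrow> 'r \<Rightarrow> 'r \<Rightarrow> generator \<Rightarrow> 'r::ring_1"
  where
    "truncated_rep A B G H x y (W_idx n) =
      (if n = 0 then A else if n = 1 then B else if odd n then x else y)"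
  | "truncated_rep A B G H x y (G_suc k) = (if k = 0 then G else 0)"
  | "truncated_rep A B G H x y (Gt_suc k) = (if k = 0 then H else 0)"

text \<open>
  If \<open>x\<close> and \<open>y\<close> are central, only the relations with \<open>k = 0\<close> have to be checked: the other ones
  hold for reasons of parity, or since the commutators in them vanish or cancel.
\<close>

lemma (in central_scalars) truncated_rep_rel:
  assumes x: "\<And>z. x * z = z * x" and y: "\<And>z. y * z = z * y"
    and AB: "A * B - B * A = s (1 / (q + inverse q)) * (H - G)"
    and AG: "s q * (A * G) - s (inverse q) * (G * A) = s (rho q kp km) * (x - B)"
    and HA: "s q * (H * A) - s (inverse q) * (A * H) = s (rho q kp km) * (x - B)"
    and GB: "s q * (G * B) - s (inverse q) * (B * G) = s (rho q kp km) * (y - A)"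
    and BH: "s q * (B * H) - s (inverse q) * (H * B) = s (rho q kp km) * (y - A)"
    and rel: "Aq_rel q kp km u v"
  shows "free_eval s (truncated_rep A B G H x y) u = free_eval s (truncated_rep A B G H x y) v"
  using rel
proof cases
  case (W0_W k)
  then show ?thesis using AB by (cases "k = 0") (simp_all add: free_eval_simps commutator_def x y)
next
  case (W_W1 k)
  then show ?thesis using AB by (cases "k = 0") (simp_all add: free_eval_simps commutator_def x y)
next
  case (W0_G k)
  then show ?thesis using AG by (cases "k = 0") (simp_all add: free_eval_simps q_commutator_def)
next
  case (Gt_W0 k)
  then show ?thesis using HA by (cases "k = 0") (simp_all add: free_eval_simps q_commutator_def)
next
  case (G_W1 k)
  then show ?thesis using GB by (cases "k = 0") (simp_all add: free_eval_simps q_commutator_def)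
next
  case (W1_Gt k)
  then show ?thesis using BH by (cases "k = 0") (simp_all add: free_eval_simps q_commutator_def)
qed (auto simp: free_eval_simps commutator_def x[of A] x[of B] x[of G] x[of H] x[of y]
       y[of A] y[of B] y[of G] y[of H])

section \<open>Upper triangular matrices of size two\<close>

text \<open>The matrix with rows \<open>(e11, e12)\<close> and \<open>(0, e22)\<close>.\<close>

datatype utri = UT (e11: complex) (e12: complex) (e22: complex)

instantiation utri :: ring_1
begin

definition zero_utri :: utri where "0 = UT 0 0 0"
definition one_utri :: utri where "1 = UT 1 0 1"
definition plus_utri :: "utri \<Rightarrow> utri \<Rightarrow> utri"
  where "u + v = UT (e11 u + e11 v) (e12 u + e12 v) (e22 u + e22 v)"
definition uminus_utri :: "utri \<Rightarrow> utri"
  where "- u = UT (- e11 u) (- e12 u) (- e22 u)"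
definition minus_utri :: "utri \<Rightarrow> utri \<Rightarrow> utri"
  where "u - v = UT (e11 u - e11 v) (e12 u - e12 v) (e22 u - e22 v)"
definition times_utri :: "utri \<Rightarrow> utri \<Rightarrow> utri"
  where "u * v = UT (e11 u * e11 v) (e11 u * e12 v + e12 u * e22 v) (e22 u * e22 v)"

lemmas utri_ops = zero_utri_def one_utri_def plus_utri_def uminus_utri_def minus_utri_def
  times_utri_def

instance
  by standard (auto simp: utri_ops algebra_simps)

end

definition utri_scalar :: "complex \<Rightarrow> utri"
  where "utri_scalar c = UT c 0 c"

interpretation utri: central_scalars utri_scalar
  by standard (simp_all add: utri_scalar_def utri_ops mult.commute)

section \<open>The exchange relation in the free algebra\<close>

text \<open>
  Representatives in the free algebra of \<open>a \<W>\<^sub>0 + b \<W>\<^sub>1\<close> and of the elements \<open>\<I>\<^bsub>2k+1\<^esub>\<close>.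
\<close>

definition Y_free :: "complex \<Rightarrow> complex \<Rightarrow> generator free_algebra"
  where "Y_free a b = scal a * W 0 + scal b * W 1"

definition I_free ::
    "complex \<Rightarrow> complex \<Rightarrow> complex \<Rightarrow> complex \<Rightarrow> complex \<Rightarrow> complex \<Rightarrow> complex \<Rightarrow> nat
      \<Rightarrow> generator free_algebra"
  where "I_free q kp km ep em lp lm k =
    scal ep * W (- int k) + scal em * W (int k + 1) +
    scal (1 / (q\<^sup>2 - inverse (q\<^sup>2))) * (scal (lm / km) * G1 k + scal (lp / kp) * Gt1 k)"

lemma I_odd_class: "I_odd q kp km ep em lp lm k = Aq_class q kp km (I_free q kp km ep em lp lm k)"
  by (simp add: I_odd_def I_free_def Let_def Wq_def Gq1_def Gtq1_def Aq_class_smult Aq_class_add)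

lemma exchange_class_iff:
  "(let A = Aq q kp km; Y = a \<odot>\<^bsub>A\<^esub> Wq q kp km 0 \<oplus>\<^bsub>A\<^esub> b \<odot>\<^bsub>A\<^esub> Wq q kp km 1
    in Y \<otimes>\<^bsub>A\<^esub> I_odd q kp km ep em lp lm k = I_odd q kp km ep' em' lp' lm' k \<otimes>\<^bsub>A\<^esub> Y) \<longleftrightarrow>
   Aq_class q kp km (Y_free a b * I_free q kp km ep em lp lm k) =
   Aq_class q kp km (I_free q kp km ep' em' lp' lm' k * Y_free a b)"
  by (simp add: Let_def I_odd_class Wq_def Aq_class_smult Aq_class_add Aq_class_mult Y_free_def)

section \<open>Sufficiency of the parameter conditions\<close>

lemma Aq_class_add_cong:
  "Aq_class q kp km x = Aq_class q kp km x' \<Longrightarrow> Aq_class q kp km y = Aq_class q kp km y' \<Longrightarrow>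
   Aq_class q kp km (x + y) = Aq_class q kp km (x' + y')"
  by (simp flip: Aq_class_add)

lemma Aq_class_scal_cong:
  "Aq_class q kp km x = Aq_class q kp km x' \<Longrightarrow>
   Aq_class q kp km (scal c * x) = Aq_class q kp km (scal c * x')"
  by (simp flip: Aq_class_smult)

lemma scal_left_commute: "x * (scal c * y) = scal c * (x * y)"
  by (metis mult.assoc scal_central)

lemma exchange_sufficient:
  fixes a b ep :: complex
  assumes "a \<noteq> 0"
  shows "Aq_class q kp km (Y_free a b * I_free q kp km ep (b / a * ep) 0 0 k) =
    Aq_class q kp km (I_free q kp km ep (b / a * ep) 0 0 k * Y_free a b)"
proof -
  let ?C = "commutator :: generator free_algebra \<Rightarrow> _"
  let ?T = "scal (1 / (q + inverse q)) * (Gt1 k - G1 k)"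
  let ?Z = "scal (a * ep) * ?C (W 0) (W (- int k)) +
    (scal (b * ep) * ?C (W 0) (W (int k + 1)) + (scal (- (b * ep)) * ?C (W (- int k)) (W 1)
     + scal (b * (b / a * ep)) * ?C (W 1) (W (int k + 1))))"
  have 1: "Aq_class q kp km (?C (W 0) (W (- int k))) = Aq_class q kp km 0"
    using Aq_class_eqI[OF Wm_Wm[of q kp km 0 k]] by simp
  have 2: "Aq_class q kp km (?C (W 1) (W (int k + 1))) = Aq_class q kp km 0"
    using Aq_class_eqI[OF Wp_Wp[of q kp km 0 k]] by simp
  have 3: "Aq_class q kp km (?C (W 0) (W (int k + 1))) = Aq_class q kp km ?T"
    by (rule Aq_class_eqI[OF W0_W])
  have 4: "Aq_class q kp km (?C (W (- int k)) (W 1)) = Aq_class q kp km ?T"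
    by (rule Aq_class_eqI[OF W_W1])
  have "Aq_class q kp km ?Z = Aq_class q kp km (scal (a * ep) * 0 +
    (scal (b * ep) * ?T + (scal (- (b * ep)) * ?T + scal (b * (b / a * ep)) * 0)))"
    by (intro Aq_class_add_cong Aq_class_scal_cong 1 2 3 4)
  also have "scal (a * ep) * 0 + (scal (b * ep) * ?T + (scal (- (b * ep)) * ?T +
      scal (b * (b / a * ep)) * 0)) = 0"
    by (simp add: scal_minus)
  finally have Z: "Aq_class q kp km ?Z = Aq_class q kp km 0" .
  define em where "em = b / a * ep"
  have em: "a * em = b * ep" using assms by (simp add: em_def)
  have merge: "scal c * (scal d * z) = scal (c * d) * z" for c d and z :: "generator free_algebra"
    by (simp add: scal_mult mult.assoc)
  have "Y_free a b * I_free q kp km ep (b / a * ep) 0 0 k -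
        I_free q kp km ep (b / a * ep) 0 0 k * Y_free a b = ?Z"
    unfolding Y_free_def I_free_def commutator_def scal_minus em_def[symmetric]
    by (simp add: scal_zero distrib_left distrib_right left_diff_distrib right_diff_distrib
        mult.assoc merge scal_left_commute[of "gen _"] em mult.commute[of ep] mult.commute[of em])
  then show ?thesis
    using Z by (simp add: Aq_class_eq_iff)
qed

section \<open>The exchange relation in triangular representations\<close>

lemma exchange_truncated_utri:
  assumes "\<And>z. x * z = z * x" and "\<And>z. y * z = z * y"
    and "A * B - B * A = utri_scalar (1 / (q + inverse q)) * (H - G)"
    and "utri_scalar q * (A * G) - utri_scalar (inverse q) * (G * A) =
      utri_scalar (rho q kp km) * (x - B)"
    and "utri_scalar q * (H * A) - utri_scalar (inverse q) * (A * H) =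
      utri_scalar (rho q kp km) * (x - B)"
    and "utri_scalar q * (G * B) - utri_scalar (inverse q) * (B * G) =
      utri_scalar (rho q kp km) * (y - A)"
    and "utri_scalar q * (B * H) - utri_scalar (inverse q) * (H * B) =
      utri_scalar (rho q kp km) * (y - A)"
    and eq: "Aq_class q kp km (Y_free a b * I_free q kp km ep em lp lm 0) =
      Aq_class q kp km (I_free q kp km ep' em' lp' lm' 0 * Y_free a b)"
  shows "(utri_scalar a * A + utri_scalar b * B) *
      (utri_scalar ep * A + utri_scalar em * B + utri_scalar (1 / (q\<^sup>2 - inverse (q\<^sup>2))) *
        (utri_scalar (lm / km) * G + utri_scalar (lp / kp) * H)) =
    (utri_scalar ep' * A + utri_scalar em' * B + utri_scalar (1 / (q\<^sup>2 - inverse (q\<^sup>2))) *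
        (utri_scalar (lm' / km) * G + utri_scalar (lp' / kp) * H)) *
      (utri_scalar a * A + utri_scalar b * B)"
  using utri.free_eval_Aq_class[OF utri.truncated_rep_rel[OF assms(1-7)] eq]
  by (simp add: Y_free_def I_free_def utri.free_eval_simps)

text \<open>
  For scalar images \<open>w0\<close>, \<open>w1\<close> of \<open>\<W>\<^sub>0\<close>, \<open>\<W>\<^sub>1\<close> and a common image \<open>t\<close> of \<open>\<G>\<^sub>1\<close>, \<open>\<G>~\<^sub>1\<close>, the relations
  can be solved for the images \<open>x\<close>, \<open>y\<close> of \<open>\<W>\<^bsub>-1\<^esub>\<close>, \<open>\<W>\<^sub>2\<close>.
\<close>

lemma exchange_character:
  fixes w0 w1 t :: complex
  assumes rho: "rho q kp km \<noteq> 0"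
    and eq: "Aq_class q kp km (Y_free a b * I_free q kp km ep em lp lm 0) =
      Aq_class q kp km (I_free q kp km ep' em' lp' lm' 0 * Y_free a b)"
  shows "(a * w0 + b * w1) *
      (ep * w0 + em * w1 + 1 / (q\<^sup>2 - inverse (q\<^sup>2)) * (lm / km + lp / kp) * t) =
    (a * w0 + b * w1) *
      (ep' * w0 + em' * w1 + 1 / (q\<^sup>2 - inverse (q\<^sup>2)) * (lm' / km + lp' / kp) * t)"
proof -
  define x y where "x = w1 + (q - inverse q) * w0 * t / rho q kp km"
    and "y = w0 + (q - inverse q) * w1 * t / rho q kp km"
  have xy: "rho q kp km * (x - w1) = (q - inverse q) * w0 * t"
    "rho q kp km * (y - w0) = (q - inverse q) * w1 * t"
    using rho by (simp_all add: x_def y_def)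
  let ?s = utri_scalar and ?r = "rho q kp km"
  have 1: "?s w0 * ?s w1 - ?s w1 * ?s w0 = ?s (1 / (q + inverse q)) * (?s t - ?s t)"
    by (simp add: utri_scalar_def utri_ops)
  have 2: "?s q * (?s w0 * ?s t) - ?s (inverse q) * (?s t * ?s w0) = ?s ?r * (?s x - ?s w1)"
    "?s q * (?s t * ?s w0) - ?s (inverse q) * (?s w0 * ?s t) = ?s ?r * (?s x - ?s w1)"
    "?s q * (?s t * ?s w1) - ?s (inverse q) * (?s w1 * ?s t) = ?s ?r * (?s y - ?s w0)"
    "?s q * (?s w1 * ?s t) - ?s (inverse q) * (?s t * ?s w1) = ?s ?r * (?s y - ?s w0)"
    using xy by (simp_all add: utri_scalar_def utri_ops) (simp_all add: algebra_simps)
  have "?s c * z = z * ?s c" for c z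
    by (rule utri.s_central)
  from arg_cong[OF exchange_truncated_utri[OF this this 1 2 eq], of e11]
  show ?thesis
    by (simp add: utri_scalar_def utri_ops) (simp add: algebra_simps)
qed

text \<open>
  A family of representations in which \<open>\<W>\<^sub>0\<close> is diagonal and \<open>\<W>\<^sub>1\<close> has the entry 1 above the
  diagonal. In the notation of the proof, the pairs \<open>(A1, A2)\<close> and \<open>(B1, B2)\<close> of their
  diagonal entries both lie on the conic \<open>(q u - q\<^bsup>-1\<^esup> v) (q v - q\<^bsup>-1\<^esup> u) = - rho\<close>. The two
  factors are \<open>P\<close>, \<open>Q\<close> for \<open>\<W>\<^sub>0\<close> and \<open>M\<close>, \<open>N\<close> for \<open>\<W>\<^sub>1\<close>. The entries of \<open>\<G>\<^sub>1\<close>, \<open>\<G>~\<^sub>1\<close> above the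
  diagonal are then forced to be \<open>Q\<close> and \<open>P\<close>, and their common diagonal \<open>g1\<close>, \<open>g2\<close> is
  determined by the relations with \<open>\<W>\<^sub>1\<close>.
  The conclusion is the entry above the diagonal of the exchange relation, with denominators cleared.
\<close>

lemma exchange_triangular:
  fixes q P Q M N :: complex
  assumes q: "q \<noteq> 0" "q\<^sup>2 - inverse (q\<^sup>2) \<noteq> 0"
    and rho: "rho q kp km \<noteq> 0"
    and PQ: "P * Q = - rho q kp km" and MN: "M * N = - rho q kp km"
    and eq: "Aq_class q kp km (Y_free a b * I_free q kp km ep em lp lm 0) =
      Aq_class q kp km (I_free q kp km ep em lp' lm' 0 * Y_free a b)"
    and sum: "lm' / km + lp' / kp = lm / km + lp / kp"
  defines "p \<equiv> inverse q"
  defines "E \<equiv> q\<^sup>2 - p\<^sup>2"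
    and "g \<equiv> lm / km" and "h \<equiv> lp / kp" and "g' \<equiv> lm' / km" and "h' \<equiv> lp' / kp"
  shows "E * (a * em - b * ep) * (q - p) * (P - Q) +
      a * ((q * P + p * Q) * (g * Q + h * P) - (q * Q + p * P) * (g' * Q + h' * P)) +
      b * ((q * M + p * N) * (g * Q + h * P) - (q * N + p * M) * (g' * Q + h' * P) -
        (g + h) * (q - p) * (P * M - Q * N)) = 0"
proof -
  let ?r = "rho q kp km"
  have E: "E \<noteq> 0" "q\<^sup>2 - inverse (q\<^sup>2) = E" using q by (auto simp: E_def p_def power_inverse)
  have fac: "E = (q - p) * (q + p)" by (simp add: E_def power2_eq_square algebra_simps)
  have qp': "q + p \<noteq> 0" using E fac by auto
  define e where "e = inverse E"
  have Ee: "E * e = 1" using E by (simp add: e_def)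
  define A1 A2 B1 B2 g1 g2
    where defs: "A1 = e * (q * P + p * Q)" "A2 = e * (q * Q + p * P)"
      "B1 = e * (q * M + p * N)" "B2 = e * (q * N + p * M)"
      "g1 = - e * (q * Q * N + p * P * M)" "g2 = - e * (q * P * M + p * Q * N)"
  have "q * A1 - p * A2 = E * e * P" "q * A2 - p * A1 = E * e * Q" "q * B1 - p * B2 = E * e * M"
     "q * B2 - p * B1 = E * e * N" "q * g1 - p * g2 = - E * e * (Q * N)"
     "q * g2 - p * g1 = - E * e * (P * M)"
    unfolding defs E_def by (simp_all add: power2_eq_square algebra_simps)
  then have lin: "q * A1 - p * A2 = P" "q * A2 - p * A1 = Q" "q * B1 - p * B2 = M"
    "q * B2 - p * B1 = N" "q * g1 - p * g2 = - (Q * N)" "q * g2 - p * g1 = - (P * M)"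
    by (simp_all add: Ee)
  have "(A1 - A2) * (q + p) = P - Q"
    unfolding lin(1,2)[symmetric] by (simp add: algebra_simps)
  then have A: "A1 - A2 = 1 / (q + p) * (P - Q)"
    using qp' by (simp add: field_simps)
  \<comment> \<open>These two identities ensure that \<open>\<W>\<^bsub>-1\<^esub>\<close> and \<open>\<W>\<^sub>2\<close> can act by scalars.\<close>
  have prod: "A1 * g1 - A2 * g2 = P * Q * (M - N) * e * (E * e)"
    "B1 * g1 - B2 * g2 = M * N * (P - Q) * e * (E * e)"
    unfolding defs E_def by (simp_all add: power2_eq_square algebra_simps)
  have diff: "A1 - A2 = (q - p) * (P - Q) * e" "B1 - B2 = (q - p) * (M - N) * e"
    unfolding defs by (simp_all add: algebra_simps)
  have diag: "(q - p) * (A1 * g1 - A2 * g2) = - ?r * (B1 - B2)"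
    "(q - p) * (B1 * g1 - B2 * g2) = - ?r * (A1 - A2)"
    unfolding prod diff Ee PQ MN by simp_all
  define x y where "x = B1 + (q - p) * A1 * g1 / ?r" and "y = A1 + (q - p) * B1 * g1 / ?r"
  have xy: "?r * (x - B1) = (q - p) * A1 * g1" "?r * (x - B2) = (q - p) * A2 * g2"
    "?r * (y - A1) = (q - p) * B1 * g1" "?r * (y - A2) = (q - p) * B2 * g2"
    using rho diag by (simp_all add: x_def y_def algebra_simps)
  let ?s = utri_scalar
  let ?A = "UT A1 0 A2" and ?B = "UT B1 1 B2" and ?G = "UT g1 Q g2" and ?H = "UT g1 P g2"
  have "q * (A1 * Q) - p * (Q * A2) = Q * (q * A1 - p * A2)"
    "q * (P * A2) - p * (A1 * P) = P * (q * A2 - p * A1)"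
    by (simp_all add: algebra_simps)
  then have AG: "q * (A1 * Q) - p * (Q * A2) = - ?r" "q * (P * A2) - p * (A1 * P) = - ?r"
    unfolding lin using PQ by (simp_all add: mult.commute)
  have "q * (g1 + Q * B2) - p * (B1 * Q + g2) = (q * g1 - p * g2) + Q * (q * B2 - p * B1)"
    "q * (B1 * P + g2) - p * (g1 + P * B2) = (q * g2 - p * g1) + P * (q * B1 - p * B2)"
    by (simp_all add: algebra_simps)
  then have GB: "q * (g1 + Q * B2) - p * (B1 * Q + g2) = 0"
    "q * (B1 * P + g2) - p * (g1 + P * B2) = 0"
    by (simp_all add: lin)
  have 1: "?A * ?B - ?B * ?A = ?s (1 / (q + inverse q)) * (?H - ?G)"
    using A by (simp add: utri_scalar_def utri_ops p_def)
  have 2: "?s q * (?A * ?G) - ?s (inverse q) * (?G * ?A) = ?s ?r * (?s x - ?B)"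
    using AG(1) xy(1,2) unfolding p_def[symmetric]
    by (simp add: utri_scalar_def utri_ops) (simp add: algebra_simps)
  have 3: "?s q * (?H * ?A) - ?s (inverse q) * (?A * ?H) = ?s ?r * (?s x - ?B)"
    using AG(2) xy(1,2) unfolding p_def[symmetric]
    by (simp add: utri_scalar_def utri_ops) (simp add: algebra_simps)
  have 4: "?s q * (?G * ?B) - ?s (inverse q) * (?B * ?G) = ?s ?r * (?s y - ?A)"
    using GB(1) xy(3,4) unfolding p_def[symmetric]
    by (simp add: utri_scalar_def utri_ops) (simp add: algebra_simps)
  have 5: "?s q * (?B * ?H) - ?s (inverse q) * (?H * ?B) = ?s ?r * (?s y - ?A)"
    using GB(2) xy(3,4) unfolding p_def[symmetric]
    by (simp add: utri_scalar_def utri_ops) (simp add: algebra_simps)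
  have "?s c * z = z * ?s c" for c z
    by (rule utri.s_central)
  note * = exchange_truncated_utri[OF this this 1 2 3 4 5 eq, unfolded E(2),
      folded g_def h_def g'_def h'_def]
  have "1 / E = e" by (simp add: e_def divide_inverse)
  then have entry: "(a * A1 + b * B1) * (em + e * (g * Q + h * P)) +
      b * (ep * A2 + em * B2 + e * (g * g2 + h * g2)) =
    (ep * A1 + em * B1 + e * (g' * g1 + h' * g1)) * b +
      (em + e * (g' * Q + h' * P)) * (a * A2 + b * B2)"
    using arg_cong[OF *, of e12] by (simp add: utri_scalar_def utri_ops)
  have sum': "g' + h' = g + h" using sum by (simp add: g_def h_def g'_def h'_def)
  define U U' where "U = g * Q + h * P" and "U' = g' * Q + h' * P"
  have "(a * A1 + b * B1) * (em + e * U) + b * (ep * A2 + em * B2 + e * ((g + h) * g2)) =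
    (ep * A1 + em * B1 + e * ((g + h) * g1)) * b + (em + e * U') * (a * A2 + b * B2)"
    using entry unfolding U_def U'_def by (simp only: distrib_right[symmetric] sum')
  then have "(a * em - b * ep) * (A1 - A2) +
      e * (a * (A1 * U - A2 * U') + b * (B1 * U - B2 * U' - (g + h) * (g1 - g2))) = 0"
    by (simp add: algebra_simps)
  then have "E * E * ((a * em - b * ep) * (A1 - A2) +
      e * (a * (A1 * U - A2 * U') + b * (B1 * U - B2 * U' - (g + h) * (g1 - g2)))) = 0"
    by simp
  then have "E * ((a * em - b * ep) * (E * (A1 - A2))) +
      E * e * (a * ((E * A1) * U - (E * A2) * U') +
        b * ((E * B1) * U - (E * B2) * U' - (g + h) * (E * g1 - E * g2))) = 0"
    by (simp add: algebra_simps)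
  moreover have "E * A1 = E * e * (q * P + p * Q)" "E * A2 = E * e * (q * Q + p * P)"
    "E * B1 = E * e * (q * M + p * N)" "E * B2 = E * e * (q * N + p * M)"
    "E * g1 - E * g2 = E * e * ((q - p) * (P * M - Q * N))"
    "E * (A1 - A2) = E * e * ((q - p) * (P - Q))"
    unfolding defs by (simp_all add: algebra_simps)
  ultimately show ?thesis
    unfolding U_def[symmetric] U'_def[symmetric] by (simp add: Ee mult.assoc add.assoc)
qed

section \<open>Necessity of the parameter conditions\<close>

text \<open>
  On \<open>P Q = M N = -r\<close> the left-hand side of \<open>F\<close> is a Laurent polynomial in \<open>P\<close> and \<open>M\<close>. Its
  parts are separated by the substitutions \<open>M \<mapsto> -M\<close> and \<open>P \<mapsto> -P\<close>, and their coefficients by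
  inserting small numbers for \<open>P\<close> and \<open>M\<close>.
\<close>

lemma triangular_entries_force:
  fixes a b ep em g h g' h' q p r E :: complex
  assumes qp: "q * p = 1" and q4: "q ^ 4 \<noteq> 1" and E0: "E = q\<^sup>2 - p\<^sup>2" and E: "E \<noteq> 0"
    and r: "r \<noteq> 0" and a: "a \<noteq> 0" and b: "b \<noteq> 0"
    and F: "\<And>P Q M N. P * Q = - r \<Longrightarrow> M * N = - r \<Longrightarrow>
      E * (a * em - b * ep) * (q - p) * (P - Q) +
      a * ((q * P + p * Q) * (g * Q + h * P) - (q * Q + p * P) * (g' * Q + h' * P)) +
      b * ((q * M + p * N) * (g * Q + h * P) - (q * N + p * M) * (g' * Q + h' * P) -
        (g + h) * (q - p) * (P * M - Q * N)) = 0"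
  shows "g = 0 \<and> h = 0 \<and> g' = 0 \<and> h' = 0 \<and> em = b / a * ep"
proof -
  define \<alpha> \<beta> \<gamma> \<delta> where "\<alpha> = q * h - p * h' - (g + h) * (q - p)" and "\<beta> = p * h - q * h'"
    and "\<gamma> = q * g - p * g'" and "\<delta> = p * g - q * g' + (g + h) * (q - p)"
  define \<kappa> \<mu> \<nu> where "\<kappa> = q * h - p * h'" and "\<mu> = p * h + q * g - p * g' - q * h'"
    and "\<nu> = p * g - q * g'"
  define D where "D = E * (a * em - b * ep) * (q - p)"
  have F': "D * (P - Q) + a * (\<kappa> * P\<^sup>2 + \<mu> * (P * Q) + \<nu> * Q\<^sup>2) +
      b * (\<alpha> * (P * M) + \<beta> * (P * N) + \<gamma> * (Q * M) + \<delta> * (Q * N)) = 0"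
    if "P * Q = - r" "M * N = - r" for P Q M N
    using F[OF that]
    by (simp add: D_def \<alpha>_def \<beta>_def \<gamma>_def \<delta>_def \<kappa>_def \<mu>_def \<nu>_def power2_eq_square algebra_simps)
  have mixed: "\<alpha> * (P * M) + \<beta> * (P * N) + \<gamma> * (Q * M) + \<delta> * (Q * N) = 0"
    if "P * Q = - r" "M * N = - r" for P Q M N
  proof -
    have "2 * b * (\<alpha> * (P * M) + \<beta> * (P * N) + \<gamma> * (Q * M) + \<delta> * (Q * N)) = 0"
      using F'[of P Q M N] F'[of P Q "- M" "- N"] that by simp Groebner_Basis.algebra
    then show ?thesis using b by simp
  qed
  then have rest: "D * (P - Q) + a * (\<kappa> * P\<^sup>2 + \<mu> * (P * Q) + \<nu> * Q\<^sup>2) = 0" if "P * Q = - r" for P Q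
    using F'[OF that that] mixed[OF that that] by simp
  have pure: "\<kappa> * P\<^sup>2 + \<mu> * (P * Q) + \<nu> * Q\<^sup>2 = 0" if "P * Q = - r" for P Q
  proof -
    have "2 * a * (\<kappa> * P\<^sup>2 + \<mu> * (P * Q) + \<nu> * Q\<^sup>2) = 0"
      using rest[of P Q] rest[of "- P" "- Q"] that by simp Groebner_Basis.algebra
    then show ?thesis using a by simp
  qed
  have linear: "D * (P - Q) = 0" if "P * Q = - r" for P Q
    using rest[OF that] pure[OF that] by simp
  \<comment> \<open>One value of \<open>P\<close> is not enough, since \<open>P = Q\<close> is possible for it.\<close>
  have "D * (1 + r) = 0" "D * (2 + r / 2) = 0"
    using linear[of 1 "- r"] linear[of 2 "- r / 2"] by simp_all
  then have "3 * D = 0" by Groebner_Basis.algebra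
  then have D: "D = 0" by simp
  have "\<beta> = 0" "\<gamma> = 0"
  proof -
    have "\<alpha> - \<beta> * r - \<gamma> * r + \<delta> * r\<^sup>2 = 0"
      using mixed[of 1 "- r" 1 "- r"] by (simp add: power2_eq_square algebra_simps)
    moreover have "4 * \<alpha> - 4 * \<beta> * r - \<gamma> * r + \<delta> * r\<^sup>2 = 0"
      using mixed[of 2 "- r / 2" 1 "- r"] by (simp add: power2_eq_square field_simps)
    moreover have "4 * \<alpha> - \<beta> * r - 4 * \<gamma> * r + \<delta> * r\<^sup>2 = 0"
      using mixed[of 1 "- r" 2 "- r / 2"] by (simp add: power2_eq_square field_simps)
    moreover have "16 * \<alpha> - 4 * \<beta> * r - 4 * \<gamma> * r + \<delta> * r\<^sup>2 = 0"
      using mixed[of 2 "- r / 2" 2 "- r / 2"] by (simp add: power2_eq_square field_simps)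
    ultimately have "9 * (\<beta> * r) = 0" "9 * (\<gamma> * r) = 0" by Groebner_Basis.algebra+
    then show "\<beta> = 0" "\<gamma> = 0" using r by auto
  qed
  moreover have "\<kappa> = 0" "\<nu> = 0"
  proof -
    have "\<kappa> - \<mu> * r + \<nu> * r\<^sup>2 = 0"
      using pure[of 1 "- r"] by simp
    moreover have "16 * \<kappa> - 4 * \<mu> * r + \<nu> * r\<^sup>2 = 0"
      using pure[of 2 "- r / 2"] by (simp add: power2_eq_square field_simps)
    moreover have "81 * \<kappa> - 9 * \<mu> * r + \<nu> * r\<^sup>2 = 0"
      using pure[of 3 "- r / 3"] by (simp add: power2_eq_square field_simps)
    ultimately have "120 * \<kappa> = 0" "120 * (\<nu> * r\<^sup>2) = 0" by Groebner_Basis.algebra+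
    then show "\<kappa> = 0" "\<nu> = 0" using r by auto
  qed
  ultimately have "p * h = q * h'" "q * h = p * h'" "q * g = p * g'" "p * g = q * g'"
    by (simp_all add: \<beta>_def \<gamma>_def \<kappa>_def \<nu>_def)
  then have "q\<^sup>2 * h' = h" "q\<^sup>2 * h = h'" "q\<^sup>2 * g = g'" "q\<^sup>2 * g' = g"
    using qp by (metis mult.assoc mult.left_neutral power2_eq_square)+
  moreover have "q ^ 4 * z = q\<^sup>2 * (q\<^sup>2 * z)" for z
    by (simp flip: power_add mult.assoc)
  ultimately have "q ^ 4 * g = g" "q ^ 4 * h = h" "q ^ 4 * g' = g'" "q ^ 4 * h' = h'"
    by (simp_all only:)
  then have zero: "g = 0" "h = 0" "g' = 0" "h' = 0"
    using q4 by auto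
  have "q - p \<noteq> 0" using E by (auto simp: E0)
  then have "a * em = b * ep" using D E by (simp add: D_def)
  then show ?thesis using zero a by (simp add: field_simps)
qed

lemma exchange_necessary:
  assumes q0: "q \<noteq> 0" and q4: "q ^ 4 \<noteq> 1"
    and k: "kp \<noteq> 0" "km \<noteq> 0" and ab: "a \<noteq> 0" "b \<noteq> 0"
    and eq: "Aq_class q kp km (Y_free a b * I_free q kp km ep em lp lm 0) =
      Aq_class q kp km (I_free q kp km ep' em' lp' lm' 0 * Y_free a b)"
  shows "ep' = ep \<and> em' = em \<and> em = (b / a) * ep \<and> lp = 0 \<and> lm = 0 \<and> lp' = 0 \<and> lm' = 0"
proof -
  have "q\<^sup>2 * (q\<^sup>2 - inverse (q\<^sup>2)) = q ^ 4 - 1"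
    using q0 by (simp add: right_diff_distrib flip: power_add)
  then have E: "q\<^sup>2 - inverse (q\<^sup>2) \<noteq> 0" using q4 by auto
  moreover have "q\<^sup>2 - inverse (q\<^sup>2) = (q - inverse q) * (q + inverse q)"
    by (simp add: power2_eq_square algebra_simps)
  ultimately have "q + inverse q \<noteq> 0" by auto
  then have rho: "rho q kp km \<noteq> 0" using k by (simp add: rho_def)
  note ch = exchange_character[OF rho eq]
  have ep: "ep' = ep" using ch[of 1 0 0] ab by simp
  have em: "em' = em" using ch[of 0 1 0] ab by simp
  have sum: "lm' / km + lp' / kp = lm / km + lp / kp"
    using ch[of 1 0 1] ab E ep by simp
  have "lm / km = 0 \<and> lp / kp = 0 \<and> lm' / km = 0 \<and> lp' / kp = 0 \<and> em = b / a * ep"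
  proof (rule triangular_entries_force[OF _ q4 refl _ rho ab])
    show "q\<^sup>2 - (inverse q)\<^sup>2 \<noteq> 0" using E by (simp add: power_inverse)
    show "q * inverse q = 1" using q0 by simp
  qed (rule exchange_triangular[OF q0 E rho _ _ eq[unfolded ep em] sum])
  then show ?thesis using ep em k by simp
qed

theorem proposition6p3:
  fixes q kp km a b ep em lp lm ep' em' lp' lm' :: complex
  assumes "q \<noteq> 0" and "\<And>n::nat. n \<ge> 1 \<Longrightarrow> q ^ n \<noteq> 1"
    and "kp \<noteq> 0" and "km \<noteq> 0"
    and "a \<noteq> 0" and "b \<noteq> 0"
  shows "(\<forall>k::nat. let A = Aq q kp km;
              Y = a \<odot>\<^bsub>A\<^esub> Wq q kp km 0 \<oplus>\<^bsub>A\<^esub> b \<odot>\<^bsub>A\<^esub> Wq q kp km 1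
            in Y \<otimes>\<^bsub>A\<^esub> I_odd q kp km ep em lp lm k = I_odd q kp km ep' em' lp' lm' k \<otimes>\<^bsub>A\<^esub> Y)
     \<longleftrightarrow> (ep' = ep \<and> em' = em \<and> em = (b / a) * ep \<and> lp = 0 \<and> lm = 0 \<and> lp' = 0 \<and> lm' = 0)"
  unfolding exchange_class_iff
proof
  assume "\<forall>k. Aq_class q kp km (Y_free a b * I_free q kp km ep em lp lm k) =
    Aq_class q kp km (I_free q kp km ep' em' lp' lm' k * Y_free a b)"
  note eq = spec[OF this, of 0]
  have "q ^ 4 \<noteq> 1" by (simp add: assms(2))
  then show "ep' = ep \<and> em' = em \<and> em = (b / a) * ep \<and> lp = 0 \<and> lm = 0 \<and> lp' = 0 \<and> lm' = 0"
    by (rule exchange_necessary[OF assms(1) _ assms(3-6) eq])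
next
  assume "ep' = ep \<and> em' = em \<and> em = (b / a) * ep \<and> lp = 0 \<and> lm = 0 \<and> lp' = 0 \<and> lm' = 0"
  then show "\<forall>k. Aq_class q kp km (Y_free a b * I_free q kp km ep em lp lm k) =
    Aq_class q kp km (I_free q kp km ep' em' lp' lm' k * Y_free a b)"
    using exchange_sufficient[OF assms(5)] by simp
qed

end
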